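(* Let $I$ be a positive integer and let $\mathcal{S}_{\mathrm{GMH}}^{I^2}\subset\mathcal{S}^{I^2}$ be the set of geometric marginal homogeneous probability tables, i.e. of all $\mathbf{P}\in\mathcal{S}^{I^2}$ with $\mathbf{P}_{\mathrm{ind}}=T(\mathbf{P}_{\mathrm{ind}})$. Then $\mathcal{S}_{\mathrm{GMH}}^{I^2}$ is a linear subspace of the vector space $(\mathcal{S}^{I^2},\oplus,\odot)$, and its dimension is $I(I-1)$.
   Context: $\mathcal{S}^{I^2}$ is the set of all $I\times I$ tables $\mathbf{P}=(p_{ij})$ of real numbers with $p_{ij}>0$ and $\sum_{i,j=1}^{I}p_{ij}=1$ (probability tables). For a table $\mathbf{R}=(r_{ij})$ with positive entries, the closure is $\mathcal{C}\mathbf{R}=\big(r_{ij}/\sum_{k,l}r_{kl}\big)_{ij}$. Perturbation: $\mathbf{P}\oplus\mathbf{Q}=\mathcal{C}(p_{ij}q_{ij})$; powering by $\alpha\in\mathbb{R}$: $\alpha\odot\mathbf{P}=\mathcal{C}(p_{ij}^{\alpha})$. With $\oplus$ as addition and $\odot$ as scalar multiplication $\mathcal{S}^{I^2}$ is a real vector space of dimension $I^2-1$. $T(\mathbf{P})$ denotes the transposed table, with $(i,j)$ entry $p_{ji}$. Let $g(row_i[\mathbf{P}])=\big(\prod_{j=1}^{I}p_{ij}\big)^{1/I}$ and $g(col_j[\mathbf{P}])=\big(\prod_{i=1}^{I}p_{ij}\big)^{1/I}$ be the geometric means of the $i$-th row and $j$-th column. Let $row(\mathbf{P})$ be the closure of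 the table whose $(i,j)$ entry is $g(row_i[\mathbf{P}])$, and $col(\mathbf{P})$ the closure of the table whose $(i,j)$ entry is $g(col_j[\mathbf{P}])$. The independent component of $\mathbf{P}$ is $\mathbf{P}_{\mathrm{ind}}=row(\mathbf{P})\oplus col(\mathbf{P})$. *)

theory Defs
  imports "HOL-Analysis.Analysis"
begin

definition table_closure :: "real ^ 'n ^ 'n \<Rightarrow> real ^ 'n ^ 'n" where
  "table_closure R = (\<chi> i j. R $ i $ j / (\<Sum>k\<in>UNIV. \<Sum>l\<in>UNIV. R $ k $ l))"

definition positive_table :: "real ^ 'n ^ 'n \<Rightarrow> bool" where
  "positive_table R \<longleftrightarrow> (\<forall>i j. 0 < R $ i $ j)"

definition is_prob_table :: "real ^ 'n ^ 'n \<Rightarrow> bool" where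
  "is_prob_table P \<longleftrightarrow> positive_table P \<and> (\<Sum>i\<in>UNIV. \<Sum>j\<in>UNIV. P $ i $ j) = 1"

lemma table_sum_pos:
  fixes R :: "real ^ 'n ^ 'n"
  assumes "positive_table R"
  shows "0 < (\<Sum>k\<in>UNIV. \<Sum>l\<in>UNIV. R $ k $ l)"
  using assms unfolding positive_table_def by (intro sum_pos) auto

lemma is_prob_table_closure:
  fixes R :: "real ^ 'n ^ 'n"
  assumes "positive_table R"
  shows "is_prob_table (table_closure R)"
  using assms table_sum_pos[OF assms]
  by (simp add: is_prob_table_def positive_table_def table_closure_def
      flip: sum_divide_distrib)

lemma table_closure_scale:
  fixes R :: "real ^ 'n ^ 'n"
  assumes "c \<noteq> 0"
  shows "table_closure (\<chi> i j. c * R $ i $ j) = table_closure R"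
  using assms by (simp add: table_closure_def flip: sum_distrib_left)

lemma table_closure_prob:
  "is_prob_table P \<Longrightarrow> table_closure P = P"
  by (simp add: is_prob_table_def table_closure_def vec_eq_iff)

lemma table_closureE:
  fixes R :: "real ^ 'n ^ 'n"
  assumes "positive_table R"
  obtains c where "c > 0" "\<And>i j. table_closure R $ i $ j = c * R $ i $ j"
  using table_sum_pos[OF assms]
  by (intro that[of "1 / (\<Sum>k\<in>UNIV. \<Sum>l\<in>UNIV. R $ k $ l)"]) (auto simp: table_closure_def)

text \<open>
  Tables of size \<open>I \<times> I\<close> with \<open>I = CARD('n)\<close>; \<open>P $ i $ j\<close> is the entry in row \<open>i\<close>, column \<open>j\<close>.
  A separate type is used because the vector space operations on \<open>real ^ 'n ^ 'n\<close> are not those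
  of the simplex.
\<close>

typedef ('n::finite) ptable = "{P :: real ^ 'n ^ 'n. is_prob_table P}"
  morphisms table Abs_ptable
proof -
  have "is_prob_table (table_closure (\<chi> i j. (1 :: real)) :: real ^ 'n ^ 'n)"
    by (rule is_prob_table_closure) (simp add: positive_table_def)
  then show ?thesis by blast
qed

setup_lifting type_definition_ptable

lemma is_prob_table_table: "is_prob_table (table P)"
  using table by auto

lemma table_pos: "0 < table P $ i $ j"
  using is_prob_table_table[of P] by (simp add: is_prob_table_def positive_table_def)

text \<open>
  The Aitchison vector space structure: \<open>P + Q\<close> is perturbation and \<open>a *\<^sub>R P\<close> is powering.
  The zero vector is the uniform table.
\<close>

instantiation ptable :: (finite) real_vector
begin

lift_definition zero_ptable :: "'a ptable" is
  "table_closure (\<chi> i j. 1)"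
  by (rule is_prob_table_closure) (simp add: positive_table_def)

lift_definition plus_ptable :: "'a ptable \<Rightarrow> 'a ptable \<Rightarrow> 'a ptable" is
  "\<lambda>P Q. table_closure (\<chi> i j. P $ i $ j * Q $ i $ j)"
  by (rule is_prob_table_closure) (simp add: is_prob_table_def positive_table_def)

lift_definition uminus_ptable :: "'a ptable \<Rightarrow> 'a ptable" is
  "\<lambda>P. table_closure (\<chi> i j. 1 / P $ i $ j)"
  by (rule is_prob_table_closure) (simp add: is_prob_table_def positive_table_def)

lift_definition minus_ptable :: "'a ptable \<Rightarrow> 'a ptable \<Rightarrow> 'a ptable" is
  "\<lambda>P Q. table_closure (\<chi> i j. P $ i $ j / Q $ i $ j)"
  by (rule is_prob_table_closure) (simp add: is_prob_table_def positive_table_def)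

lift_definition scaleR_ptable :: "real \<Rightarrow> 'a ptable \<Rightarrow> 'a ptable" is
  "\<lambda>a P. table_closure (\<chi> i j. P $ i $ j powr a)"
  by (rule is_prob_table_closure)
    (simp add: is_prob_table_def positive_table_def less_le)

lemma ptable_eqI:
  fixes P Q :: "'a ptable"
  assumes "c \<noteq> 0" "\<And>i j. table P $ i $ j = c * table Q $ i $ j"
  shows "P = Q"
proof -
  have "table_closure (table P) = table_closure (\<chi> i j. c * table Q $ i $ j)"
    by (rule arg_cong[where f = table_closure]) (simp add: vec_eq_iff assms)
  also have "\<dots> = table_closure (table Q)"
    by (rule table_closure_scale) fact
  finally show ?thesis
    by (simp add: table_closure_prob is_prob_table_table table_inject)
qed

lemma table_zeroE:
  obtains c where "c > 0" "\<And>i j. table (0 :: 'a ptable) $ i $ j = c"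
  by (rule table_closureE[of "(\<chi> i j. 1) :: real ^ 'a ^ 'a"])
    (auto simp: positive_table_def zero_ptable.rep_eq)

lemma table_plusE:
  fixes P Q :: "'a ptable"
  obtains c where "c > 0" "\<And>i j. table (P + Q) $ i $ j = c * (table P $ i $ j * table Q $ i $ j)"
  by (rule table_closureE[of "\<chi> i j. table P $ i $ j * table Q $ i $ j"])
    (auto simp: positive_table_def plus_ptable.rep_eq table_pos)

lemma table_uminusE:
  fixes P :: "'a ptable"
  obtains c where "c > 0" "\<And>i j. table (- P) $ i $ j = c * (1 / table P $ i $ j)"
  by (rule table_closureE[of "\<chi> i j. 1 / table P $ i $ j"])
    (auto simp: positive_table_def uminus_ptable.rep_eq table_pos)

lemma table_minusE:
  fixes P Q :: "'a ptable"
  obtains c where "c > 0" "\<And>i j. table (P - Q) $ i $ j = c * (table P $ i $ j / table Q $ i $ j)"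
  by (rule table_closureE[of "\<chi> i j. table P $ i $ j / table Q $ i $ j"])
    (auto simp: positive_table_def minus_ptable.rep_eq table_pos)

lemma table_scaleRE:
  fixes P :: "'a ptable"
  obtains c where "c > 0" "\<And>i j. table (a *\<^sub>R P) $ i $ j = c * (table P $ i $ j powr a)"
  by (rule table_closureE[of "\<chi> i j. table P $ i $ j powr a"])
    (auto simp: positive_table_def scaleR_ptable.rep_eq less_imp_neq[OF table_pos, symmetric])

instance
proof
  fix P Q R :: "'a ptable" and a b :: real
  show "P + Q + R = P + (Q + R)"
  proof -
    obtain c1 where 1: "c1 > 0" "\<And>i j. table (P + Q) $ i $ j = c1 * (table P $ i $ j * table Q $ i $ j)"
      by (rule table_plusE) blast
    obtain c2 where 2: "c2 > 0" "\<And>i j. table (P + Q + R) $ i $ j = c2 * (table (P + Q) $ i $ j * table R $ i $ j)"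
      by (rule table_plusE) blast
    obtain c3 where 3: "c3 > 0" "\<And>i j. table (Q + R) $ i $ j = c3 * (table Q $ i $ j * table R $ i $ j)"
      by (rule table_plusE) blast
    obtain c4 where 4: "c4 > 0" "\<And>i j. table (P + (Q + R)) $ i $ j = c4 * (table P $ i $ j * table (Q + R) $ i $ j)"
      by (rule table_plusE) blast
    show ?thesis
      by (rule ptable_eqI[of "c1 * c2 / (c3 * c4)"]) (use 1 2 3 4 in \<open>simp_all add: field_simps\<close>)
  qed
  show "P + Q = Q + P"
    by transfer (simp add: mult.commute)
  show "0 + P = P"
  proof -
    obtain c1 where 1: "c1 > 0" "\<And>i j. table (0 :: 'a ptable) $ i $ j = c1"
      by (rule table_zeroE) blast
    obtain c2 where 2: "c2 > 0" "\<And>i j. table (0 + P) $ i $ j = c2 * (table 0 $ i $ j * table P $ i $ j)"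
      by (rule table_plusE) blast
    show ?thesis
      by (rule ptable_eqI[of "c1 * c2"]) (use 1 2 in simp_all)
  qed
  show "- P + P = 0"
  proof -
    obtain c1 where 1: "c1 > 0" "\<And>i j. table (0 :: 'a ptable) $ i $ j = c1"
      by (rule table_zeroE) blast
    obtain c2 where 2: "c2 > 0" "\<And>i j. table (- P + P) $ i $ j = c2 * (table (- P) $ i $ j * table P $ i $ j)"
      by (rule table_plusE) blast
    obtain c3 where 3: "c3 > 0" "\<And>i j. table (- P) $ i $ j = c3 * (1 / table P $ i $ j)"
      by (rule table_uminusE) blast
    show ?thesis
      by (rule ptable_eqI[of "c2 * c3 / c1"])
        (use 1 2 3 in \<open>simp_all add: less_imp_neq[OF table_pos, symmetric]\<close>)
  qed
  show "P - Q = P + - Q"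
  proof -
    obtain c1 where 1: "c1 > 0" "\<And>i j. table (P - Q) $ i $ j = c1 * (table P $ i $ j / table Q $ i $ j)"
      by (rule table_minusE) blast
    obtain c2 where 2: "c2 > 0" "\<And>i j. table (P + - Q) $ i $ j = c2 * (table P $ i $ j * table (- Q) $ i $ j)"
      by (rule table_plusE) blast
    obtain c3 where 3: "c3 > 0" "\<And>i j. table (- Q) $ i $ j = c3 * (1 / table Q $ i $ j)"
      by (rule table_uminusE) blast
    show ?thesis
      by (rule ptable_eqI[of "c1 / (c2 * c3)"]) (use 1 2 3 in simp_all)
  qed
  show "a *\<^sub>R (P + Q) = a *\<^sub>R P + a *\<^sub>R Q"
  proof -
    obtain c1 where 1: "c1 > 0" "\<And>i j. table (P + Q) $ i $ j = c1 * (table P $ i $ j * table Q $ i $ j)"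
      by (rule table_plusE) blast
    obtain c2 where 2: "c2 > 0" "\<And>i j. table (a *\<^sub>R (P + Q)) $ i $ j = c2 * (table (P + Q) $ i $ j powr a)"
      by (rule table_scaleRE) blast
    obtain c3 where 3: "c3 > 0" "\<And>i j. table (a *\<^sub>R P) $ i $ j = c3 * (table P $ i $ j powr a)"
      by (rule table_scaleRE) blast
    obtain c4 where 4: "c4 > 0" "\<And>i j. table (a *\<^sub>R Q) $ i $ j = c4 * (table Q $ i $ j powr a)"
      by (rule table_scaleRE) blast
    obtain c5 where 5: "c5 > 0" "\<And>i j. table (a *\<^sub>R P + a *\<^sub>R Q) $ i $ j =
        c5 * (table (a *\<^sub>R P) $ i $ j * table (a *\<^sub>R Q) $ i $ j)"
      by (rule table_plusE) blast
    show ?thesis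
      by (rule ptable_eqI[of "c2 * c1 powr a / (c3 * c4 * c5)"])
        (use 1 2 3 4 5 in \<open>simp_all add: powr_mult less_imp_le[OF table_pos]\<close>)
  qed
  show "(a + b) *\<^sub>R P = a *\<^sub>R P + b *\<^sub>R P"
  proof -
    obtain c2 where 2: "c2 > 0" "\<And>i j. table ((a + b) *\<^sub>R P) $ i $ j = c2 * (table P $ i $ j powr (a + b))"
      by (rule table_scaleRE) blast
    obtain c3 where 3: "c3 > 0" "\<And>i j. table (a *\<^sub>R P) $ i $ j = c3 * (table P $ i $ j powr a)"
      by (rule table_scaleRE) blast
    obtain c4 where 4: "c4 > 0" "\<And>i j. table (b *\<^sub>R P) $ i $ j = c4 * (table P $ i $ j powr b)"
      by (rule table_scaleRE) blast
    obtain c5 where 5: "c5 > 0" "\<And>i j. table (a *\<^sub>R P + b *\<^sub>R P) $ i $ j =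
        c5 * (table (a *\<^sub>R P) $ i $ j * table (b *\<^sub>R P) $ i $ j)"
      by (rule table_plusE) blast
    show ?thesis
      by (rule ptable_eqI[of "c2 / (c3 * c4 * c5)"])
        (use 2 3 4 5 in \<open>simp_all add: powr_add\<close>)
  qed
  show "a *\<^sub>R b *\<^sub>R P = (a * b) *\<^sub>R P"
  proof -
    obtain c2 where 2: "c2 > 0" "\<And>i j. table ((a * b) *\<^sub>R P) $ i $ j = c2 * (table P $ i $ j powr (a * b))"
      by (rule table_scaleRE) blast
    obtain c3 where 3: "c3 > 0" "\<And>i j. table (b *\<^sub>R P) $ i $ j = c3 * (table P $ i $ j powr b)"
      by (rule table_scaleRE) blast
    obtain c4 where 4: "c4 > 0" "\<And>i j. table (a *\<^sub>R b *\<^sub>R P) $ i $ j = c4 * (table (b *\<^sub>R P) $ i $ j powr a)"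
      by (rule table_scaleRE) blast
    show ?thesis
      by (rule ptable_eqI[of "c4 * c3 powr a / c2"])
        (use 2 3 4 in \<open>simp_all add: powr_mult powr_powr mult.commute\<close>)
  qed
  show "1 *\<^sub>R P = P"
  proof -
    obtain c where "c > 0" "\<And>i j. table (1 *\<^sub>R P) $ i $ j = c * (table P $ i $ j powr 1)"
      by (rule table_scaleRE) blast
    then show ?thesis
      by (intro ptable_eqI[of c]) (simp_all add: less_imp_le[OF table_pos])
  qed
qed

end

lift_definition transpose_table :: "'n::finite ptable \<Rightarrow> 'n ptable" is transpose
proof -
  fix P :: "real ^ 'n ^ 'n"
  assume "is_prob_table P"
  then show "is_prob_table (transpose P)"
    unfolding is_prob_table_def positive_table_def transpose_def
    by (simp, subst sum.swap) simp
qed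

definition row_gmean :: "'n::finite ptable \<Rightarrow> 'n \<Rightarrow> real" where
  "row_gmean P i = (\<Prod>j\<in>UNIV. table P $ i $ j) powr (1 / real CARD('n))"

definition col_gmean :: "'n::finite ptable \<Rightarrow> 'n \<Rightarrow> real" where
  "col_gmean P j = (\<Prod>i\<in>UNIV. table P $ i $ j) powr (1 / real CARD('n))"

lemma row_gmean_pos: "0 < row_gmean P i"
  by (simp add: row_gmean_def less_imp_neq[OF prod_pos[OF table_pos], symmetric] table_pos
      less_imp_neq[OF table_pos, symmetric])

lemma col_gmean_pos: "0 < col_gmean P j"
  by (simp add: col_gmean_def less_imp_neq[OF prod_pos[OF table_pos], symmetric] table_pos
      less_imp_neq[OF table_pos, symmetric])

lift_definition row_table :: "'n::finite ptable \<Rightarrow> 'n ptable" is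
  "\<lambda>P. table_closure (\<chi> i j. row_gmean P i)"
  by (rule is_prob_table_closure) (simp add: positive_table_def row_gmean_pos)

lift_definition col_table :: "'n::finite ptable \<Rightarrow> 'n ptable" is
  "\<lambda>P. table_closure (\<chi> i j. col_gmean P j)"
  by (rule is_prob_table_closure) (simp add: positive_table_def col_gmean_pos)

definition ind_table :: "'n::finite ptable \<Rightarrow> 'n ptable" where
  "ind_table P = row_table P + col_table P"

definition geom_marginal_homogeneous :: "'n::finite ptable set" where
  "geom_marginal_homogeneous = {P. ind_table P = transpose_table (ind_table P)}"

end

theory Submission
  imports Defs
begin

text \<open>
  Taking logarithms turns the simplex into the tables of reals modulo constants. There, geometric
  marginal homogeneity says that every row sum equals the column sum of the same index, i.e. the
  table is a circulation on the complete digraph with loops. Fix an index \<open>o'\<close>: modulo constants we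
  may let row \<open>o'\<close> and column \<open>o'\<close> have sum \<open>0\<close>, and then the entries outside row \<open>o'\<close> can be chosen
  freely and determine row \<open>o'\<close>. This leaves \<open>I * (I - 1)\<close> free entries.
\<close>

text \<open>The softmax map. With the entrywise logarithm as right inverse, it identifies the
  simplex with the tables of reals modulo constant tables, so that all counting can be done in
  additive coordinates.\<close>

lift_definition exp_table :: "real ^ 'n ^ 'n \<Rightarrow> 'n::finite ptable" is
  "\<lambda>A. table_closure (\<chi> i j. exp (A $ i $ j))"
  by (rule is_prob_table_closure) (simp add: positive_table_def)

lemma exp_tableE:
  obtains c where "c > 0" "\<And>i j. table (exp_table A) $ i $ j = c * exp (A $ i $ j)"
  by (rule table_closureE[of "\<chi> i j. exp (A $ i $ j)"])
    (auto simp: positive_table_def exp_table.rep_eq)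

lemma linear_exp_table: "linear (exp_table :: real ^ 'n ^ 'n \<Rightarrow> 'n::finite ptable)"
proof
  fix A B :: "real ^ 'n ^ 'n" and r :: real
  obtain a where a: "a > 0" "\<And>i j. table (exp_table A) $ i $ j = a * exp (A $ i $ j)"
    by (rule exp_tableE) blast
  obtain b where b: "b > 0" "\<And>i j. table (exp_table B) $ i $ j = b * exp (B $ i $ j)"
    by (rule exp_tableE) blast
  show "exp_table (A + B) = exp_table A + exp_table B"
  proof -
    obtain c where c: "c > 0" "\<And>i j. table (exp_table (A + B)) $ i $ j = c * exp ((A + B) $ i $ j)"
      by (rule exp_tableE) blast
    obtain d where d: "d > 0" "\<And>i j. table (exp_table A + exp_table B) $ i $ j =
        d * (table (exp_table A) $ i $ j * table (exp_table B) $ i $ j)"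
      by (rule table_plusE) blast
    show ?thesis
      by (rule ptable_eqI[of "c / (a * b * d)"]) (use a b c d in \<open>simp_all add: exp_add\<close>)
  qed
  show "exp_table (r *\<^sub>R A) = r *\<^sub>R exp_table A"
  proof -
    obtain c where c: "c > 0" "\<And>i j. table (exp_table (r *\<^sub>R A)) $ i $ j = c * exp ((r *\<^sub>R A) $ i $ j)"
      by (rule exp_tableE) blast
    obtain d where d: "d > 0" "\<And>i j. table (r *\<^sub>R exp_table A) $ i $ j =
        d * (table (exp_table A) $ i $ j powr r)"
      by (rule table_scaleRE) blast
    show ?thesis
      by (rule ptable_eqI[of "c / (a powr r * d)"])
        (use a c d in \<open>simp_all add: powr_mult exp_powr_real mult.commute\<close>)
  qed
qed

text \<open>Closure forgets a common positive factor and nothing else. In logarithmic coordinates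
  this factor becomes the additive constant \<open>c\<close>.\<close>

lemma exp_table_eq_iff:
  "exp_table A = exp_table B \<longleftrightarrow> (\<exists>c. \<forall>i j. A $ i $ j = c + B $ i $ j)"
proof
  obtain a where a: "a > 0" "\<And>i j. table (exp_table A) $ i $ j = a * exp (A $ i $ j)"
    by (rule exp_tableE) blast
  obtain b where b: "b > 0" "\<And>i j. table (exp_table B) $ i $ j = b * exp (B $ i $ j)"
    by (rule exp_tableE) blast
  {
    assume eq: "exp_table A = exp_table B"
    have "A $ i $ j = ln (b / a) + B $ i $ j" for i j
    proof -
      have "ln (a * exp (A $ i $ j)) = ln (b * exp (B $ i $ j))"
        using a(2) b(2) eq by metis
      then show ?thesis
        using a(1) b(1) by (simp add: ln_mult ln_div)
    qed
    then show "\<exists>c. \<forall>i j. A $ i $ j = c + B $ i $ j"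
      by blast
  next
    assume "\<exists>c. \<forall>i j. A $ i $ j = c + B $ i $ j"
    then obtain c where c: "\<And>i j. A $ i $ j = c + B $ i $ j"
      by blast
    show "exp_table A = exp_table B"
      by (rule ptable_eqI[of "a * exp c / b"]) (use a b c in \<open>simp_all add: exp_add\<close>)
  }
qed

lemma exp_table_ln: "exp_table (\<chi> i j. ln (table P $ i $ j)) = P"
proof -
  obtain c where "c > 0" "\<And>i j. table (exp_table (\<chi> i j. ln (table P $ i $ j))) $ i $ j =
      c * exp ((\<chi> i j. ln (table P $ i $ j)) $ i $ j)"
    by (rule exp_tableE) blast
  then show ?thesis
    by (intro ptable_eqI[of c]) (simp_all add: table_pos)
qed

lemma ln_row_gmean: "ln (row_gmean P i) = (\<Sum>j\<in>UNIV. ln (table P $ i $ j)) / CARD('n)"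
  for P :: "'n::finite ptable"
  by (simp add: row_gmean_def ln_powr ln_prod less_imp_neq[OF table_pos, symmetric] table_pos)

lemma ln_col_gmean: "ln (col_gmean P j) = (\<Sum>i\<in>UNIV. ln (table P $ i $ j)) / CARD('n)"
  for P :: "'n::finite ptable"
  by (simp add: col_gmean_def ln_powr ln_prod less_imp_neq[OF table_pos, symmetric] table_pos)

lemma ind_tableE:
  obtains c where "c > 0" "\<And>i j. table (ind_table P) $ i $ j = c * (row_gmean P i * col_gmean P j)"
proof -
  obtain a where a: "a > 0" "\<And>i j. table (row_table P) $ i $ j = a * row_gmean P i"
    by (rule table_closureE[of "\<chi> i j. row_gmean P i"])
      (auto simp: positive_table_def row_table.rep_eq row_gmean_pos)
  obtain b where b: "b > 0" "\<And>i j. table (col_table P) $ i $ j = b * col_gmean P j"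
    by (rule table_closureE[of "\<chi> i j. col_gmean P j"])
      (auto simp: positive_table_def col_table.rep_eq col_gmean_pos)
  obtain d where d: "d > 0" "\<And>i j. table (row_table P + col_table P) $ i $ j =
      d * (table (row_table P) $ i $ j * table (col_table P) $ i $ j)"
    by (rule table_plusE) blast
  show thesis
    by (rule that[of "a * b * d"]) (use a b d in \<open>simp_all add: ind_table_def\<close>)
qed

text \<open>With \<open>R\<close> and \<open>C\<close> the row and column sums of the logarithms,
  entry \<open>(i, j)\<close> of the independent component is proportional to
  \<open>exp ((R i + C j) / CARD('n))\<close>. Symmetry therefore makes \<open>R - C\<close>
  constant, and the constant is 0 because \<open>R\<close> and \<open>C\<close> have the same
  total.\<close>

lemma geom_marginal_homogeneous_iff_ln:
  fixes P :: "'n::finite ptable"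
  shows "P \<in> geom_marginal_homogeneous \<longleftrightarrow>
    (\<forall>i. (\<Sum>j\<in>UNIV. ln (table P $ i $ j)) = (\<Sum>j\<in>UNIV. ln (table P $ j $ i)))"
proof -
  define R where "R i = (\<Sum>j\<in>UNIV. ln (table P $ i $ j))" for i
  define C where "C i = (\<Sum>j\<in>UNIV. ln (table P $ j $ i))" for i
  obtain c where c: "c > 0"
      "\<And>i j. table (ind_table P) $ i $ j = c * (row_gmean P i * col_gmean P j)"
    by (rule ind_tableE) blast
  have ln_ind: "ln (row_gmean P i * col_gmean P j) = (R i + C j) / CARD('n)" for i j
    by (subst ln_mult_pos) (simp_all add: row_gmean_pos col_gmean_pos ln_row_gmean ln_col_gmean
        R_def C_def add_divide_distrib)
  \<comment> \<open>The factor \<open>c\<close> cancels, since transposed entries belong to the same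
    table \<open>ind_table P\<close>.\<close>
  have "P \<in> geom_marginal_homogeneous \<longleftrightarrow>
      (\<forall>i j. row_gmean P i * col_gmean P j = row_gmean P j * col_gmean P i)"
    using c by (simp add: geom_marginal_homogeneous_def transpose_table.rep_eq transpose_def
        vec_eq_iff flip: table_inject)
  also have "\<dots> \<longleftrightarrow>
      (\<forall>i j. ln (row_gmean P i * col_gmean P j) = ln (row_gmean P j * col_gmean P i))"
    by (simp add: ln_inj_iff row_gmean_pos col_gmean_pos)
  also have "\<dots> \<longleftrightarrow> (\<forall>i j. R i + C j = R j + C i)"
    by (simp add: ln_ind)
  also have "\<dots> \<longleftrightarrow> (\<forall>i. R i = C i)"
  proof (intro iffI allI)
    fix i
    assume "\<forall>i j. R i + C j = R j + C i"
    then have "R j - C j = R i - C i" for j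
      by (simp add: algebra_simps)
    then have "(\<Sum>j\<in>UNIV. R j - C j) = (\<Sum>j\<in>(UNIV :: 'n set). R i - C i)"
      by (rule sum.cong[OF refl])
    moreover have "(\<Sum>j\<in>UNIV. R j) = (\<Sum>j\<in>UNIV. C j)"
      unfolding R_def C_def by (rule sum.swap)
    ultimately show "R i = C i"
      by (simp add: sum_subtractf)
  qed simp
  finally show ?thesis
    by (simp add: R_def C_def)
qed

text \<open>The normalising factor \<open>c\<close> adds \<open>CARD('n) * ln c\<close> to every row
  sum and every column sum, so it drops out of the comparison.\<close>

lemma exp_table_in_geom_marginal_homogeneous_iff:
  fixes A :: "real ^ 'n::finite ^ 'n"
  shows "exp_table A \<in> geom_marginal_homogeneous \<longleftrightarrow>
    (\<forall>i. (\<Sum>j\<in>UNIV. A $ i $ j) = (\<Sum>j\<in>UNIV. A $ j $ i))"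
proof -
  obtain c where "c > 0" "\<And>i j. table (exp_table A) $ i $ j = c * exp (A $ i $ j)"
    by (rule exp_tableE) blast
  then show ?thesis
    by (simp add: geom_marginal_homogeneous_iff_ln ln_mult sum.distrib)
qed

text \<open>If row \<open>o'\<close> of \<open>x\<close> is zero, the new entry in column
  \<open>j\<close> is exactly what column \<open>j\<close> lacks to reach the sum of row
  \<open>j\<close>. The result is then a circulation.\<close>

definition fill_row :: "'n \<Rightarrow> real ^ 'n::finite ^ 'n \<Rightarrow> real ^ 'n ^ 'n" where
  "fill_row o' x = (\<chi> i j. if i = o' then (\<Sum>k\<in>UNIV. x $ j $ k) - (\<Sum>k\<in>UNIV. x $ k $ j)
     else x $ i $ j)"

lemma linear_fill_row: "linear (fill_row o')"
  by (rule linearI)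
    (simp_all add: fill_row_def vec_eq_iff sum.distrib sum_distrib_left algebra_simps)

lemma sum_row_fill_row:
  assumes "x $ o' = 0"
  shows "(\<Sum>j\<in>UNIV. fill_row o' x $ i $ j) = (\<Sum>j\<in>UNIV. x $ i $ j)"
proof (cases "i = o'")
  case True
  \<comment> \<open>The entries of the new row add up to the total of the row sums minus the total
    of the column sums of \<open>x\<close>, hence to 0, the sum of the old row.\<close>
  have "(\<Sum>j\<in>UNIV. \<Sum>k\<in>UNIV. x $ j $ k) = (\<Sum>j\<in>UNIV. \<Sum>k\<in>UNIV. x $ k $ j)"
    by (rule sum.swap)
  then show ?thesis
    using True assms by (simp add: fill_row_def sum_subtractf)
qed (simp add: fill_row_def)

lemma sum_col_fill_row:
  fixes x :: "real ^ 'n::finite ^ 'n"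
  assumes "x $ o' = 0"
  shows "(\<Sum>i\<in>UNIV. fill_row o' x $ i $ j) = (\<Sum>i\<in>UNIV. x $ j $ i)"
proof -
  have "(\<Sum>i\<in>UNIV. fill_row o' x $ i $ j)
      = fill_row o' x $ o' $ j + (\<Sum>i\<in>UNIV - {o'}. fill_row o' x $ i $ j)"
    by (rule sum.remove) simp_all
  also have "(\<Sum>i\<in>UNIV - {o'}. fill_row o' x $ i $ j) = (\<Sum>i\<in>UNIV - {o'}. x $ i $ j)"
    by (rule sum.cong) (simp_all add: fill_row_def)
  also have "\<dots> = (\<Sum>i\<in>UNIV. x $ i $ j)"
    using assms by (subst sum.remove[of UNIV o' "\<lambda>i. x $ i $ j"]) simp_all
  finally show ?thesis
    by (simp add: fill_row_def)
qed

lemma subspace_row_zero: "subspace {x :: real ^ 'n::finite ^ 'n. x $ o' = 0}"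
  by (simp add: subspace_def)

text \<open>A coordinate subspace: it is spanned by the matrix units outside row \<open>o'\<close>,
  which form \<open>d\<close>.\<close>

lemma dim_row_zero:
  "dim {x :: real ^ 'n::finite ^ 'n. x $ o' = 0} = CARD('n) * (CARD('n) - 1)"
proof -
  define d :: "(real ^ 'n ^ 'n) set" where
    "d = (\<lambda>(i, j). axis i (axis j 1)) ` ((UNIV - {o'}) \<times> UNIV)"
  have inj: "inj_on (\<lambda>(i, j). axis i (axis j 1) :: real ^ 'n ^ 'n) ((UNIV - {o'}) \<times> UNIV)"
    by (auto simp: inj_on_def axis_eq_axis)
  have d: "d \<subseteq> Basis"
    by (auto simp: d_def Basis_vec_def)
  have notin: "axis i (axis j 1) \<notin> d \<longleftrightarrow> i = o'" for i j
    by (force simp: d_def axis_eq_axis)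
  have "{x. \<forall>b\<in>Basis. b \<notin> d \<longrightarrow> x \<bullet> b = 0} = {x :: real ^ 'n ^ 'n. x $ o' = 0}"
    by (force simp: Basis_vec_def notin inner_axis vec_eq_iff)
  with dim_substandard[OF d] have "dim {x :: real ^ 'n ^ 'n. x $ o' = 0} = card d"
    by simp
  also have "\<dots> = CARD('n) * (CARD('n) - 1)"
    by (simp add: d_def card_image[OF inj] card_cartesian_product mult.commute)
  finally show ?thesis .
qed

text \<open>The filled row \<open>o'\<close> sums to 0, which leaves no room for an additive
  constant. The remaining rows of the filled table still show \<open>x\<close>.\<close>

lemma inj_on_exp_table_fill_row: "inj_on (exp_table \<circ> fill_row o') {x :: real ^ 'n::finite ^ 'n. x $ o' = 0}"
proof (rule inj_onI)
  fix x y :: "real ^ 'n ^ 'n"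
  assume "x \<in> {x. x $ o' = 0}" "y \<in> {x. x $ o' = 0}"
  then have x: "x $ o' = 0" and y: "y $ o' = 0"
    by simp_all
  assume "(exp_table \<circ> fill_row o') x = (exp_table \<circ> fill_row o') y"
  then obtain c where c: "\<And>i j. fill_row o' x $ i $ j = c + fill_row o' y $ i $ j"
    by (auto simp: exp_table_eq_iff)
  have "(\<Sum>j\<in>UNIV. fill_row o' x $ o' $ j) = CARD('n) * c + (\<Sum>j\<in>UNIV. fill_row o' y $ o' $ j)"
    by (simp add: c sum.distrib)
  then have "c = 0"
    by (simp add: sum_row_fill_row x y)
  have "x $ i $ j = y $ i $ j" for i j
    using c[of i j] \<open>c = 0\<close> x y by (cases "i = o'") (simp_all add: fill_row_def)
  then show "x = y"
    by (simp add: vec_eq_iff)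
qed

lemma geom_marginal_homogeneous_eq_image:
  fixes o' :: "'n::finite"
  shows "geom_marginal_homogeneous = (exp_table \<circ> fill_row o') ` {x. x $ o' = 0}"
proof (intro equalityI subsetI)
  fix P :: "'n ptable"
  assume P: "P \<in> geom_marginal_homogeneous"
  define L where "L = (\<chi> i j. ln (table P $ i $ j))"
  \<comment> \<open>Subtracting the mean of row \<open>o'\<close> picks the representative modulo
    constants whose row \<open>o'\<close> sums to 0, as it does in every filled table.\<close>
  define A where "A = (\<chi> i j. L $ i $ j - (\<Sum>k\<in>UNIV. L $ o' $ k) / CARD('n))"
  define x where "x = (\<chi> i j. if i = o' then 0 else A $ i $ j)"
  have "exp_table A = exp_table L"
    unfolding exp_table_eq_iff
    by (rule exI[of _ "- ((\<Sum>k\<in>UNIV. L $ o' $ k) / CARD('n))"]) (simp add: A_def)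
  also have "\<dots> = P"
    unfolding L_def by (rule exp_table_ln)
  finally have A: "exp_table A = P" .
  with P have marg: "(\<Sum>k\<in>UNIV. A $ i $ k) = (\<Sum>k\<in>UNIV. A $ k $ i)" for i
    using exp_table_in_geom_marginal_homogeneous_iff by blast
  have row: "(\<Sum>k\<in>UNIV. A $ o' $ k) = 0"
    by (simp add: A_def sum_subtractf)
  have x: "x $ o' = 0"
    by (simp add: x_def vec_eq_iff)
  \<comment> \<open>Erasing row \<open>o'\<close> of \<open>A\<close> preserves even the sum of that
    row, because it is already 0.\<close>
  have xrow: "(\<Sum>k\<in>UNIV. x $ j $ k) = (\<Sum>k\<in>UNIV. A $ j $ k)" for j
    by (cases "j = o'") (simp_all add: x_def row)
  have xcol: "(\<Sum>k\<in>UNIV. x $ k $ j) = (\<Sum>k\<in>UNIV. A $ k $ j) - A $ o' $ j" for j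
  proof -
    have "(\<Sum>k\<in>UNIV. x $ k $ j) = (\<Sum>k\<in>UNIV - {o'}. A $ k $ j)"
      using sum.remove[of UNIV o' "\<lambda>k. x $ k $ j"] by (simp add: x_def)
    then show ?thesis
      using sum.remove[of UNIV o' "\<lambda>k. A $ k $ j"] by simp
  qed
  \<comment> \<open>In row \<open>o'\<close> the filled entry is the sum of row \<open>j\<close> of
    \<open>A\<close>, minus that of column \<open>j\<close>, plus \<open>A $ o' $ j\<close>. The
    first two cancel by \<open>marg\<close>.\<close>
  have "fill_row o' x $ i $ j = A $ i $ j" for i j
    using marg[of j] by (cases "i = o'") (simp_all add: fill_row_def xrow xcol, simp add: x_def)
  then have "fill_row o' x = A"
    by (simp add: vec_eq_iff)
  with A x show "P \<in> (exp_table \<circ> fill_row o') ` {x. x $ o' = 0}"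
    by (intro image_eqI[of _ _ x]) simp_all
\<comment> \<open>Conversely, row \<open>i\<close> and column \<open>i\<close> of a filled table
  both have the sum of row \<open>i\<close> of \<open>x\<close>.\<close>
qed (auto simp: exp_table_in_geom_marginal_homogeneous_iff sum_row_fill_row sum_col_fill_row)

theorem theorem5:
  "subspace (geom_marginal_homogeneous :: 'n::finite ptable set) \<and>
   dim (geom_marginal_homogeneous :: 'n ptable set) = CARD('n) * (CARD('n) - 1)"
proof -
  fix o' :: 'n
  let ?S = "{x :: real ^ 'n ^ 'n. x $ o' = 0}"
  let ?f = "exp_table \<circ> fill_row o'"
  have lin: "linear ?f"
    by (intro linear_compose linear_fill_row linear_exp_table)
  obtain B where B: "B \<subseteq> ?S" "independent B" "?S \<subseteq> span B" "card B = dim ?S"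
    by (rule basis_exists)
  have span: "span B = ?S"
    using B subspace_row_zero by (intro equalityI span_minimal)
  \<comment> \<open>\<open>?f\<close> is injective on \<open>?S\<close> but not on all tables, so
    dimensions are compared through the basis \<open>B\<close> of \<open>?S\<close>, whose image is
    a basis of the image.\<close>
  have inj: "inj_on ?f (span B)"
    unfolding span by (rule inj_on_exp_table_fill_row)
  have "dim (?f ` ?S) = card (?f ` B)"
  proof (rule dim_eq_card)
    show "span (?f ` B) = span (?f ` ?S)"
      using linear_span_image[OF lin] span span_span by metis
    show "independent (?f ` B)"
      using lin B(2) inj by (rule linear_independent_injective_image)
  qed
  also have "card (?f ` B) = card B"
    by (rule card_image[OF inj_on_subset[OF inj span_superset]])
  finally have "dim (?f ` ?S) = CARD('n) * (CARD('n) - 1)"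
    by (simp only: B(4) dim_row_zero)
  moreover have "subspace (?f ` ?S)"
    using lin subspace_row_zero by (rule linear_subspace_image)
  ultimately show ?thesis
    unfolding geom_marginal_homogeneous_eq_image[of o'] by blast
qed

end
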